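(* Let $X\subset\mathbb{R}^n\setminus\{0\}$ be a finite multiset of full rank $n$, and let $\mathcal{P}_+(X)=\mathrm{span}\{p_Y:\ Y\subset X\}$. Then $\Pi=\mathcal{P}_+(X)\oplus\mathcal{I}_+(X)$ (direct sum of vector spaces).
   Context: Repeated vectors of $X$ are treated as distinct elements; subsets, set differences and cardinalities are taken with multiplicity. $\Pi=\mathbb{C}[t_1,\dots,t_n]$. For $y\in\mathbb{R}^n$, $p_y(t)=y\cdot t$, and for a finite multiset $Y\subset\mathbb{R}^n$, $p_Y=\prod_{y\in Y}p_y$ (with $p_\emptyset=1$). Spans are over $\mathbb{C}$. A facet hyperplane of $X$ is a linear subspace $H\subset\mathbb{R}^n$ with $\dim H=n-1$ and $\mathrm{span}(X\cap H)=H$; $\mathcal{F}(X)$ is the set of facet hyperplanes. For $H\in\mathcal{F}(X)$, $\eta_H$ is a nonzero normal vector to $H$ and $m(H)=\#(X\setminus H)$. $\mathcal{I}_+(X)$ is the ideal of $\Pi$ generated by $p_{\eta_H}^{m(H)+1}$, $H\in\mathcal{F}(X)$. *)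

theory Defs
  imports "HOL-Analysis.Analysis" "HOL-Library.Multiset" "HOL-Library.Poly_Mapping"
begin

text \<open>
  The ring of complex polynomials in variables \<open>t\<^sub>i\<close> indexed by the finite type \<open>'n\<close>: finitely
  supported maps from exponent vectors to coefficients, whose ring multiplication is convolution.
\<close>
type_synonym 'n cpoly = "('n \<Rightarrow>\<^sub>0 nat) \<Rightarrow>\<^sub>0 complex"

definition cpoly_scale :: "complex \<Rightarrow> 'n cpoly \<Rightarrow> 'n cpoly" where
  "cpoly_scale c p = Poly_Mapping.single 0 c * p"

interpretation cpoly: vector_space "cpoly_scale :: complex \<Rightarrow> 'n cpoly \<Rightarrow> 'n cpoly"
  by unfold_locales
    (simp_all add: cpoly_scale_def algebra_simps single_add mult_single flip: mult.assoc)

text \<open>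
  A commutative ring is a module over itself, and its submodules are its ideals; so
  \<open>ideal.span\<close> is the generated ideal.
\<close>
interpretation ideal: module "(*) :: 'a::comm_ring_1 \<Rightarrow> 'a \<Rightarrow> 'a"
  by unfold_locales (simp_all add: algebra_simps)

definition cpoly_direct_sum :: "'n cpoly set \<Rightarrow> 'n cpoly set \<Rightarrow> 'n cpoly set \<Rightarrow> bool" where
  "cpoly_direct_sum V U W \<longleftrightarrow>
     cpoly.subspace U \<and> cpoly.subspace W \<and> V = {u + w |u w. u \<in> U \<and> w \<in> W} \<and> U \<inter> W = {0}"

definition linear_form :: "real ^ 'n::finite \<Rightarrow> 'n cpoly" where
  "linear_form y =
     (\<Sum>i\<in>UNIV. Poly_Mapping.single (Poly_Mapping.single i 1) (complex_of_real (y $ i)))"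

definition form_prod :: "(real ^ 'n::finite) multiset \<Rightarrow> 'n cpoly" where
  "form_prod Y = (\<Prod>y\<in>#Y. linear_form y)"

definition facet_hyperplanes :: "(real ^ 'n::finite) multiset \<Rightarrow> (real ^ 'n) set set" where
  "facet_hyperplanes X =
     {H. subspace H \<and> dim H = CARD('n) - 1 \<and> span (set_mset X \<inter> H) = H}"

definition off_count :: "(real ^ 'n::finite) multiset \<Rightarrow> (real ^ 'n) set \<Rightarrow> nat" where
  "off_count X H = size (filter_mset (\<lambda>x. x \<notin> H) X)"

definition normal_choice ::
    "(real ^ 'n::finite) multiset \<Rightarrow> ((real ^ 'n) set \<Rightarrow> real ^ 'n) \<Rightarrow> bool" where
  "normal_choice X \<eta> \<longleftrightarrow> (\<forall>H \<in> facet_hyperplanes X. \<eta> H \<noteq> 0 \<and> (\<forall>x\<in>H. \<eta> H \<bullet> x = 0))"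

definition P_plus :: "(real ^ 'n::finite) multiset \<Rightarrow> 'n cpoly set" where
  "P_plus X = cpoly.span {form_prod Y |Y. Y \<subseteq># X}"

definition I_plus ::
    "(real ^ 'n::finite) multiset \<Rightarrow> ((real ^ 'n) set \<Rightarrow> real ^ 'n) \<Rightarrow> 'n cpoly set" where
  "I_plus X \<eta> = ideal.span {linear_form (\<eta> H) ^ (off_count X H + 1) |H. H \<in> facet_hyperplanes X}"

end

theory Submission
  imports Defs "HOL-Computational_Algebra.Polynomial"
begin

text \<open>
  The pairing \<open>\<langle>p, q\<rangle> = \<Sum>\<^sub>m m! p\<^sub>m q\<^sub>m\<close> makes multiplication by the linear form of \<open>h\<close> adjoint to the
  directional derivative along \<open>h\<close>, and \<open>\<langle>conj p, p\<rangle>\<close> is positive definite. A product of linear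
  forms from \<open>X\<close> has degree at most \<open>m(H)\<close> along the normal of \<open>H\<close>, so \<open>P\<^sub>+\<close> is orthogonal to
  \<open>I\<^sub>+\<close>; as \<open>P\<^sub>+\<close> is closed under conjugation, the two intersect trivially.

  If the sum were not everything, some linear functional vanishing on it would be nonzero on forms
  of some degree \<open>d\<close>, where it is represented by a polynomial \<open>f\<close> whose degree along every facet
  normal is at most \<open>m(H)\<close>. Such an \<open>f\<close> lies in \<open>P\<^sub>+\<close>, so the functional vanishes on \<open>conj f\<close> and
  \<open>f = 0\<close>. That \<open>f\<close> lies in \<open>P\<^sub>+\<close> is shown by deletion and contraction, for functions on an
  arbitrary subspace \<open>U\<close>: removing \<open>x\<close> from \<open>X\<close>, find \<open>g'\<close> agreeing with \<open>f\<close> on \<open>U \<inter> x\<^sup>\<bottom>\<close>, divide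
  \<open>f - g'\<close> by the linear form of \<open>x\<close>, and treat the quotient on \<open>U\<close>, or again on \<open>U \<inter> x\<^sup>\<bottom>\<close>
  if \<open>x\<close> is a coloop.
\<close>

section \<open>Evaluation and directional derivatives\<close>

lemma poly_mapping_single_induct [case_names zero single add]:
  assumes "P 0"
    and "\<And>k v. P (Poly_Mapping.single k v)"
    and "\<And>p q. P p \<Longrightarrow> P q \<Longrightarrow> P (p + q)"
  shows "P (p :: 'a \<Rightarrow>\<^sub>0 'b::comm_monoid_add)"
proof (induction p rule: Poly_Mapping.update_induct)
  case const
  then show ?case by fact
next
  case (update f a b)
  have "Poly_Mapping.update a b f = f + Poly_Mapping.single a b"
    using update(1)
    by (intro poly_mapping_eqI) (auto simp: lookup_update lookup_add lookup_single in_keys_iff when_def)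
  then show ?case using assms update by simp
qed

text \<open>\<open>F\<close> receives the coefficient as an argument, so the target needs no scalar
  action; evaluation, restriction to lines, derivatives, the pairing and homogeneous parts are all
  instances.\<close>

definition linear_extension :: "('k \<Rightarrow> 'c \<Rightarrow> 'b) \<Rightarrow> ('k \<Rightarrow>\<^sub>0 'c::comm_monoid_add) \<Rightarrow> 'b::comm_monoid_add"
  where "linear_extension F p = (\<Sum>k\<in>Poly_Mapping.keys p. F k (Poly_Mapping.lookup p k))"

lemma linear_extension_zero [simp]: "linear_extension F 0 = 0"
  by (simp add: linear_extension_def)

lemma linear_extension_single:
  assumes "F k 0 = 0"
  shows "linear_extension F (Poly_Mapping.single k c) = F k c"
  using assms by (simp add: linear_extension_def)

lemma linear_extension_add:
  assumes "\<And>k. F k 0 = 0" "\<And>k c d. F k (c + d) = F k c + F k d"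
  shows "linear_extension F (p + q) = linear_extension F p + linear_extension F q"
  unfolding linear_extension_def by (rule setsum_keys_plus_distrib) (use assms in auto)

text \<open>The target ring is general because variables are replaced both by numbers and by
  univariate polynomials.\<close>

definition monom_val :: "('n::finite \<Rightarrow> 'b::comm_semiring_1) \<Rightarrow> ('n \<Rightarrow>\<^sub>0 nat) \<Rightarrow> 'b" where
  "monom_val v m = (\<Prod>i\<in>UNIV. v i ^ Poly_Mapping.lookup m i)"

lemma monom_val_zero [simp]: "monom_val v 0 = 1"
  by (simp add: monom_val_def)

lemma monom_val_add: "monom_val v (m + k) = monom_val v m * monom_val v k"
  by (simp add: monom_val_def lookup_add power_add prod.distrib)

lemma monom_val_single [simp]: "monom_val v (Poly_Mapping.single i 1) = v i"
proof -
  have "monom_val v (Poly_Mapping.single i 1) = (\<Prod>j\<in>UNIV. if j = i then v i else 1)"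
    unfolding monom_val_def by (intro prod.cong) (auto simp: lookup_single when_def)
  then show ?thesis by simp
qed

text \<open>Real points suffice: they determine a complex polynomial, see
  \<open>eval_at_inject\<close>.\<close>

definition eval_at :: "real ^ 'n::finite \<Rightarrow> 'n cpoly \<Rightarrow> complex" where
  "eval_at u = linear_extension (\<lambda>m c. c * monom_val (\<lambda>i. complex_of_real (u $ i)) m)"

lemma eval_at_zero [simp]: "eval_at u 0 = 0"
  by (simp add: eval_at_def)

lemma eval_at_single: "eval_at u (Poly_Mapping.single m c) = c * monom_val (\<lambda>i. complex_of_real (u $ i)) m"
  by (simp add: eval_at_def linear_extension_single)

lemma eval_at_const [simp]: "eval_at u (Poly_Mapping.single 0 c) = c"
  by (simp add: eval_at_single)

lemma eval_at_one [simp]: "eval_at u 1 = 1"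
  using eval_at_const[of u 1] by simp

lemma eval_at_add [simp]: "eval_at u (p + q) = eval_at u p + eval_at u q"
  by (simp add: eval_at_def linear_extension_add distrib_right)

lemma eval_at_mult [simp]: "eval_at u (p * q) = eval_at u p * eval_at u q"
proof (induction p rule: poly_mapping_single_induct)
  case (single m c)
  show ?case
    by (induction q rule: poly_mapping_single_induct)
      (simp_all add: distrib_left eval_at_single mult_single monom_val_add)
qed (simp_all add: distrib_right)

lemma eval_at_uminus [simp]: "eval_at u (- p) = - eval_at u p"
  by (metis add_eq_0_iff eval_at_add eval_at_zero)

lemma eval_at_diff [simp]: "eval_at u (p - q) = eval_at u p - eval_at u q"
  using eval_at_add[of u p "- q"] by simp

lemma eval_at_sum [simp]: "eval_at u (sum f A) = (\<Sum>a\<in>A. eval_at u (f a))"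
  by (induction A rule: infinite_finite_induct) simp_all

lemma eval_at_scale [simp]: "eval_at u (cpoly_scale c p) = c * eval_at u p"
  by (simp add: cpoly_scale_def)

lemma eval_at_linear_form [simp]: "eval_at u (linear_form y) = complex_of_real (y \<bullet> u)"
  by (simp add: linear_form_def eval_at_single inner_vec_def del: One_nat_def)

lemma eval_at_form_prod: "eval_at u (form_prod Y) = complex_of_real (\<Prod>y\<in>#Y. y \<bullet> u)"
  by (induction Y) (simp_all add: form_prod_def)

lemma cpoly_ring_induct [case_names const var add mult]:
  fixes p :: "'n::finite cpoly"
  assumes const: "\<And>c. P (Poly_Mapping.single 0 c)"
    and var: "\<And>i. P (Poly_Mapping.single (Poly_Mapping.single i 1) 1)"
    and add: "\<And>p q. P p \<Longrightarrow> P q \<Longrightarrow> P (p + q)"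
    and mult: "\<And>p q. P p \<Longrightarrow> P q \<Longrightarrow> P (p * q)"
  shows "P p"
proof (induction p rule: poly_mapping_single_induct)
  case zero
  then show ?case using const[of 0] by simp
next
  case (single m c)
  have one: "P (Poly_Mapping.single m 1)"
  proof (induction m rule: poly_mapping_single_induct)
    case (single i k)
    show ?case
    proof (induction k)
      case (Suc k)
      have "Poly_Mapping.single (Poly_Mapping.single i (Suc k)) (1::complex) =
        Poly_Mapping.single (Poly_Mapping.single i 1) 1 * Poly_Mapping.single (Poly_Mapping.single i k) 1"
        by (simp add: mult_single flip: single_add)
      then show ?case using mult var Suc by simp
    qed (use const[of 1] in simp)
  next
    case (add m k)
    have "Poly_Mapping.single (m + k) (1::complex) = Poly_Mapping.single m 1 * Poly_Mapping.single k 1"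
      by (simp add: mult_single)
    then show ?case using mult add by simp
  qed (use const[of 1] in simp)
  have "Poly_Mapping.single m c = Poly_Mapping.single 0 c * Poly_Mapping.single m 1"
    by (simp add: mult_single)
  then show ?case using mult const one by simp
qed (use add in auto)

section \<open>Restrictions to lines and directional derivatives\<close>

definition line_poly :: "real ^ 'n::finite \<Rightarrow> real ^ 'n \<Rightarrow> 'n cpoly \<Rightarrow> complex poly" where
  "line_poly a h = linear_extension
     (\<lambda>m c. smult c (monom_val (\<lambda>i. [:complex_of_real (a $ i), complex_of_real (h $ i):]) m))"

lemma line_poly_zero [simp]: "line_poly a h 0 = 0"
  by (simp add: line_poly_def)

lemma line_poly_single: "line_poly a h (Poly_Mapping.single m c) =
    smult c (monom_val (\<lambda>i. [:complex_of_real (a $ i), complex_of_real (h $ i):]) m)"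
  by (simp add: line_poly_def linear_extension_single)

lemma line_poly_add [simp]: "line_poly a h (p + q) = line_poly a h p + line_poly a h q"
  by (simp add: line_poly_def linear_extension_add smult_add_left)

lemma poly_line_poly: "poly (line_poly a h p) (complex_of_real t) = eval_at (a + t *\<^sub>R h) p"
  by (induction p rule: poly_mapping_single_induct)
    (simp_all add: line_poly_single eval_at_single monom_val_def poly_prod)

text \<open>A nonzero polynomial has only finitely many roots. The exceptional set \<open>S\<close>
  later lets a line avoid its intersection with a hyperplane.\<close>

lemma complex_poly_eqI_cofinite_real:
  fixes p q :: "complex poly"
  assumes "finite S" "\<And>t::real. t \<notin> S \<Longrightarrow> poly p (of_real t) = poly q (of_real t)"
  shows "p = q"
proof (rule ccontr)
  assume "p \<noteq> q"
  then have "finite {z. poly (p - q) z = 0}"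
    by (intro poly_roots_finite) simp
  moreover have "complex_of_real ` (- S) \<subseteq> {z. poly (p - q) z = 0}"
    using assms by auto
  ultimately have "finite (complex_of_real ` (- S))"
    by (rule rev_finite_subset)
  then have "finite (- S)"
    by (rule finite_imageD) (simp add: inj_on_def)
  with assms(1) have "finite (UNIV :: real set)"
    using finite_compl by blast
  then show False by (simp add: infinite_UNIV_char_0)
qed

lemma line_poly_eqI:
  assumes "\<And>t. eval_at (a + t *\<^sub>R h) p = poly q (of_real t)"
  shows "line_poly a h p = q"
  by (rule complex_poly_eqI_cofinite_real[of "{}"]) (use assms in \<open>auto simp: poly_line_poly\<close>)

text \<open>If \<open>m\<close> has exponent zero at \<open>i\<close>, truncated subtraction leaves
  \<open>m\<close> unchanged, but the factor \<open>lookup m i\<close> kills the term.\<close>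

definition dir_deriv :: "real ^ 'n::finite \<Rightarrow> 'n cpoly \<Rightarrow> 'n cpoly" where
  "dir_deriv h = linear_extension (\<lambda>m c. \<Sum>i\<in>UNIV. Poly_Mapping.single (m - Poly_Mapping.single i 1)
     (c * of_nat (Poly_Mapping.lookup m i) * complex_of_real (h $ i)))"

lemma dir_deriv_zero [simp]: "dir_deriv h 0 = 0"
  by (simp add: dir_deriv_def)

lemma dir_deriv_single: "dir_deriv h (Poly_Mapping.single m c) =
   (\<Sum>i\<in>UNIV. Poly_Mapping.single (m - Poly_Mapping.single i 1)
     (c * of_nat (Poly_Mapping.lookup m i) * complex_of_real (h $ i)))"
  by (simp add: dir_deriv_def linear_extension_single)

lemma dir_deriv_add [simp]: "dir_deriv h (p + q) = dir_deriv h p + dir_deriv h q"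
  unfolding dir_deriv_def
  by (rule linear_extension_add)
    (simp_all only: mult_zero_left single_zero sum.neutral_const distrib_right single_add sum.distrib)

lemma line_poly_sum [simp]: "line_poly a h (sum f A) = (\<Sum>x\<in>A. line_poly a h (f x))"
  by (induction A rule: infinite_finite_induct) simp_all

lemma monom_val_minus_single:
  assumes "Poly_Mapping.lookup m i > 0"
  shows "monom_val v (m - Poly_Mapping.single i 1) =
    v i ^ (Poly_Mapping.lookup m i - 1) * (\<Prod>j\<in>UNIV-{i}. v j ^ Poly_Mapping.lookup m j)"
proof -
  have "monom_val v (m - Poly_Mapping.single i 1) =
     (\<Prod>j\<in>insert i (UNIV - {i}). v j ^ Poly_Mapping.lookup (m - Poly_Mapping.single i 1) j)"
    unfolding monom_val_def by (intro prod.cong) auto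
  also have "\<dots> = v i ^ (Poly_Mapping.lookup m i - 1) *
     (\<Prod>j\<in>UNIV-{i}. v j ^ Poly_Mapping.lookup (m - Poly_Mapping.single i 1) j)"
    by (subst prod.insert) (auto simp: lookup_minus lookup_single)
  also have "(\<Prod>j\<in>UNIV-{i}. v j ^ Poly_Mapping.lookup (m - Poly_Mapping.single i 1) j) =
     (\<Prod>j\<in>UNIV-{i}. v j ^ Poly_Mapping.lookup m j)"
    by (intro prod.cong) (auto simp: lookup_minus lookup_single when_def)
  finally show ?thesis .
qed

lemma smult_sum_right: "smult c (sum f A) = (\<Sum>x\<in>A. smult c (f x))"
  by (induction A rule: infinite_finite_induct) (simp_all add: smult_add_right)

text \<open>Chain rule: on the line, variable \<open>i\<close> becomes the linear polynomial
  \<open>v i\<close> with derivative \<open>h $ i\<close>, so the summands of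
  \<open>dir_deriv\<close> match those of the product rule one by one.\<close>

lemma line_poly_dir_deriv: "line_poly a h (dir_deriv h p) = pderiv (line_poly a h p)"
proof (induction p rule: poly_mapping_single_induct)
  case (single m c)
  define v where "v i = [:complex_of_real (a $ i), complex_of_real (h $ i):]" for i
  have "line_poly a h (Poly_Mapping.single (m - Poly_Mapping.single i 1)
       (c * of_nat (Poly_Mapping.lookup m i) * complex_of_real (h $ i))) =
     smult c ((\<Prod>j\<in>UNIV-{i}. v j ^ Poly_Mapping.lookup m j) * pderiv (v i ^ Poly_Mapping.lookup m i))"
    for i
  proof (cases "Poly_Mapping.lookup m i")
    case 0
    then show ?thesis by simp
  next
    case (Suc k)
    then have "line_poly a h (Poly_Mapping.single (m - Poly_Mapping.single i 1)
         (c * of_nat (Poly_Mapping.lookup m i) * complex_of_real (h $ i))) =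
      smult (c * of_nat (Suc k) * complex_of_real (h $ i))
        (v i ^ k * (\<Prod>j\<in>UNIV-{i}. v j ^ Poly_Mapping.lookup m j))"
      unfolding line_poly_single v_def[symmetric] by (subst monom_val_minus_single) simp_all
    moreover have "pderiv (v i ^ Suc k) = smult (of_nat (Suc k) * complex_of_real (h $ i)) (v i ^ k)"
      unfolding pderiv_power_Suc by (simp add: v_def pderiv_pCons mult.commute)
    ultimately show ?thesis
      unfolding Suc by (simp only: mult_smult_right smult_smult ac_simps)
  qed
  then show ?case
    unfolding dir_deriv_single line_poly_sum
    unfolding line_poly_single pderiv_smult v_def[symmetric] monom_val_def pderiv_prod
    by (simp only: smult_sum_right)
qed (simp_all add: pderiv_add)

lemma line_poly_dir_deriv_funpow: "line_poly a h ((dir_deriv h ^^ k) p) = (pderiv ^^ k) (line_poly a h p)"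
  by (induction k) (simp_all add: line_poly_dir_deriv)

text \<open>In characteristic zero each derivative lowers a positive degree by exactly one.\<close>

lemma funpow_pderiv_eq_0_iff:
  fixes q :: "complex poly"
  shows "(pderiv ^^ Suc k) q = 0 \<longleftrightarrow> degree q \<le> k"
proof (induction k arbitrary: q)
  case 0
  then show ?case by (simp add: pderiv_eq_0_iff)
next
  case (Suc k)
  have "(pderiv ^^ Suc (Suc k)) q = 0 \<longleftrightarrow> degree (pderiv q) \<le> k"
    using Suc[of "pderiv q"] by (simp only: funpow_Suc_right o_apply)
  then show ?case by (simp add: degree_pderiv) linarith
qed

text \<open>Turns a degree bound into the vanishing of one fixed polynomial at the points of
  \<open>U\<close>, the form that fits adjointness and density arguments. Lines along
  \<open>h\<close> from points of \<open>U\<close> stay in \<open>U\<close>.\<close>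

lemma degree_line_poly_le_iff:
  assumes "subspace U" "h \<in> U"
  shows "(\<forall>a\<in>U. degree (line_poly a h p) \<le> k) \<longleftrightarrow> (\<forall>a\<in>U. eval_at a ((dir_deriv h ^^ Suc k) p) = 0)"
proof -
  have "(\<forall>a\<in>U. degree (line_poly a h p) \<le> k) \<longleftrightarrow> (\<forall>a\<in>U. line_poly a h ((dir_deriv h ^^ Suc k) p) = 0)"
    by (simp only: line_poly_dir_deriv_funpow funpow_pderiv_eq_0_iff)
  also have "\<dots> \<longleftrightarrow> (\<forall>a\<in>U. eval_at a ((dir_deriv h ^^ Suc k) p) = 0)" (is "?l \<longleftrightarrow> ?r")
  proof
    assume ?l
    then show ?r by (metis add.right_neutral poly_0 poly_line_poly scale_zero_left)
  next
    assume r: ?r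
    show ?l
      by (intro ballI line_poly_eqI) (use r assms in \<open>simp add: subspace_add subspace_scale\<close>)
  qed
  finally show ?thesis .
qed

section \<open>The apolar pairing and homogeneous parts\<close>

definition monom_fact :: "('n::finite \<Rightarrow>\<^sub>0 nat) \<Rightarrow> nat" where
  "monom_fact m = (\<Prod>i\<in>UNIV. fact (Poly_Mapping.lookup m i))"

lemma monom_fact_pos: "monom_fact m > 0"
  by (simp add: monom_fact_def prod_pos)

lemma monom_fact_single_add:
  "monom_fact (Poly_Mapping.single i 1 + m) = Suc (Poly_Mapping.lookup m i) * monom_fact m"
proof -
  have "monom_fact (Poly_Mapping.single i 1 + m) =
      (\<Prod>j\<in>UNIV. (if j = i then Suc (Poly_Mapping.lookup m i) else 1) * fact (Poly_Mapping.lookup m j))"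
    unfolding monom_fact_def
    by (intro prod.cong) (auto simp: lookup_add lookup_single when_def)
  also have "\<dots> = Suc (Poly_Mapping.lookup m i) * monom_fact m"
    by (simp only: prod.distrib monom_fact_def prod.delta finite_UNIV) simp
  finally show ?thesis .
qed

text \<open>The apolar pairing: \<open>p\<close> acts on \<open>q\<close> as a differential operator
  and the result is evaluated at 0. It is bilinear, not sesquilinear; positivity comes from
  conjugating one argument.\<close>

definition pairing :: "'n::finite cpoly \<Rightarrow> 'n cpoly \<Rightarrow> complex" where
  "pairing p q = linear_extension (\<lambda>m c. c * of_nat (monom_fact m) * Poly_Mapping.lookup q m) p"

lemma pairing_zero_left [simp]: "pairing 0 q = 0"
  by (simp add: pairing_def)

lemma pairing_zero_right [simp]: "pairing p 0 = 0"
  by (simp add: pairing_def linear_extension_def)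

lemma pairing_add_left: "pairing (p + p') q = pairing p q + pairing p' q"
  by (simp add: pairing_def linear_extension_add distrib_right)

lemma pairing_add_right: "pairing p (q + q') = pairing p q + pairing p q'"
  by (simp add: pairing_def linear_extension_def lookup_add distrib_left sum.distrib)

lemma pairing_single_left:
  "pairing (Poly_Mapping.single m c) q = c * of_nat (monom_fact m) * Poly_Mapping.lookup q m"
  by (simp add: pairing_def linear_extension_single)

lemma pairing_sum_left: "pairing (sum f A) q = (\<Sum>a\<in>A. pairing (f a) q)"
  by (induction A rule: infinite_finite_induct) (simp_all add: pairing_add_left)

lemma pairing_nondegenerate:
  assumes "\<And>p. pairing p q = 0"
  shows "q = 0"
proof (rule poly_mapping_eqI)
  fix m
  have "of_nat (monom_fact m) * Poly_Mapping.lookup q m = 0"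
    using assms[of "Poly_Mapping.single m 1"] by (simp add: pairing_single_left)
  then show "Poly_Mapping.lookup q m = Poly_Mapping.lookup 0 m"
    using monom_fact_pos[of m] by simp
qed

lemma linear_form_mult_single:
  "linear_form h * Poly_Mapping.single m c =
     (\<Sum>i\<in>UNIV. Poly_Mapping.single (Poly_Mapping.single i 1 + m) (complex_of_real (h $ i) * c))"
  by (simp only: linear_form_def sum_distrib_right mult_single)

text \<open>By bilinearity it suffices to compare monomials, where the new exponent in
  \<open>monom_fact\<close> is exactly the factor produced by differentiation.\<close>

lemma pairing_linear_form_mult: "pairing (linear_form h * p) q = pairing p (dir_deriv h q)"
proof (induction p rule: poly_mapping_single_induct)
  case (single m c)
  show ?case
  proof (induction q rule: poly_mapping_single_induct)
    case (single k d)
    have "complex_of_real (h $ i) * c * of_nat (monom_fact (Poly_Mapping.single i 1 + m)) *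
          Poly_Mapping.lookup (Poly_Mapping.single k d) (Poly_Mapping.single i 1 + m) =
        c * of_nat (monom_fact m) *
          Poly_Mapping.lookup (Poly_Mapping.single (k - Poly_Mapping.single i 1)
            (d * of_nat (Poly_Mapping.lookup k i) * complex_of_real (h $ i))) m" for i
    proof (cases "k = Poly_Mapping.single i 1 + m")
      case True
      then have "k - Poly_Mapping.single i 1 = m"
        "Poly_Mapping.lookup k i = Suc (Poly_Mapping.lookup m i)"
        by (simp_all add: lookup_add)
      then show ?thesis
        using monom_fact_single_add[of i m] unfolding True[symmetric]
        by (simp only: lookup_single_eq of_nat_mult ac_simps)
    next
      case False
      \<comment> \<open>Truncated subtraction can give \<open>m\<close> even though \<open>k\<close>
        is not the shifted \<open>m\<close>, but only at exponent zero, where the coefficient on the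
        right vanishes.\<close>
      have "Poly_Mapping.lookup k i = 0" if "k - Poly_Mapping.single i 1 = m"
      proof (rule ccontr)
        assume "Poly_Mapping.lookup k i \<noteq> 0"
        then have "k = Poly_Mapping.single i 1 + (k - Poly_Mapping.single i 1)"
          by (intro poly_mapping_eqI) (auto simp: lookup_add lookup_minus lookup_single when_def)
        with that False show False by simp
      qed
      with False show ?thesis
        by (auto simp: lookup_single when_def)
    qed
    then show ?case
      unfolding linear_form_mult_single pairing_sum_left pairing_single_left dir_deriv_single lookup_sum
      by (simp only: sum_distrib_left)
  qed (simp_all add: pairing_add_right)
qed (simp_all add: pairing_add_left distrib_left)

lemma pairing_linear_form_power_mult:
  "pairing (linear_form h ^ k * p) q = pairing p ((dir_deriv h ^^ k) q)"
proof (induction k arbitrary: q)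
  case (Suc k)
  show ?case
    unfolding power_Suc mult.assoc pairing_linear_form_mult Suc funpow_Suc_right o_apply ..
qed simp

lemma pairing_const_mult: "pairing (Poly_Mapping.single 0 c * p) q = c * pairing p q"
  by (induction p rule: poly_mapping_single_induct)
    (simp_all add: pairing_add_left distrib_left mult_single pairing_single_left)

lemma linear_form_axis: "linear_form (axis i 1) = Poly_Mapping.single (Poly_Mapping.single i 1) 1"
proof -
  have "linear_form (axis i 1) =
      (\<Sum>j\<in>UNIV. if i = j then Poly_Mapping.single (Poly_Mapping.single j 1) 1 else 0)"
    unfolding linear_form_def by (intro sum.cong) (auto simp: axis_def)
  then show ?thesis by simp
qed

text \<open>Vanishing at all real points is inherited by directional derivatives. By adjointness,
  every pairing with \<open>p\<close> reduces to values of its derivatives at 0, so nondegeneracy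
  applies.\<close>

lemma eval_at_eq_0_imp_zero:
  fixes p :: "'n::finite cpoly"
  assumes "\<And>u. eval_at u p = 0"
  shows "p = 0"
proof (rule pairing_nondegenerate)
  fix q :: "'n cpoly"
  have vanish: "\<forall>u. eval_at u (dir_deriv h r) = 0" if "\<forall>u. eval_at u r = 0" for h and r :: "'n cpoly"
  proof
    fix u
    have "line_poly u h r = 0"
      by (rule line_poly_eqI) (use that in simp)
    then have "line_poly u h (dir_deriv h r) = 0"
      by (simp add: line_poly_dir_deriv)
    then show "eval_at u (dir_deriv h r) = 0"
      using poly_line_poly[of u h "dir_deriv h r" 0] by simp
  qed
  have const: "pairing (Poly_Mapping.single 0 c) r = 0" if "\<forall>u. eval_at u r = 0" for c and r :: "'n cpoly"
  proof -
    have "eval_at 0 s = Poly_Mapping.lookup s 0" for s :: "'n cpoly"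
    proof (induction s rule: poly_mapping_single_induct)
      case (single m d)
      show ?case
      proof (cases "m = 0")
        case False
        then obtain i where "Poly_Mapping.lookup m i \<noteq> 0"
          by (metis lookup_zero poly_mapping_eqI)
        with False show ?thesis
          by (auto simp: eval_at_single monom_val_def lookup_single when_def intro!: bexI[of _ i])
      qed (simp add: eval_at_single)
    qed (simp_all add: lookup_add)
    with that have "Poly_Mapping.lookup r 0 = 0" by metis
    then show ?thesis by (simp add: pairing_single_left)
  qed
  \<comment> \<open>Phrased for a multiplier \<open>q\<close> acting on any \<open>s\<close> that
    pairs to zero with all vanishing polynomials, so that the product case is mere
    composition.\<close>
  have "\<forall>s. (\<forall>r. (\<forall>u. eval_at u r = 0) \<longrightarrow> pairing s r = 0) \<longrightarrow>
      (\<forall>r. (\<forall>u. eval_at u r = 0) \<longrightarrow> pairing (q * s) r = 0)"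
  proof (induction q rule: cpoly_ring_induct)
    case (const c)
    then show ?case by (simp add: pairing_const_mult)
  next
    case (var i)
    have "Poly_Mapping.single (Poly_Mapping.single i 1) 1 = linear_form (axis i 1)"
      by (simp add: linear_form_axis)
    then show ?case using vanish by (simp only: pairing_linear_form_mult) blast
  next
    case (add p q)
    then show ?case by (simp add: distrib_right pairing_add_left)
  next
    case (mult p q)
    then show ?case unfolding mult.assoc by blast
  qed
  moreover have "\<forall>r :: 'n cpoly. (\<forall>u. eval_at u r = 0) \<longrightarrow> pairing 1 r = 0"
    using const[where c = 1] unfolding single_one by blast
  ultimately have "pairing (q * 1) p = 0"
    using assms by blast
  then show "pairing q p = 0"
    by simp
qed

lemma eval_at_inject:
  assumes "\<And>u. eval_at u p = eval_at u q"
  shows "p = q"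
  using eval_at_eq_0_imp_zero[of "p - q"] assms by simp

section \<open>Conjugation of coefficients and positive definiteness\<close>

definition conj_cpoly :: "'n cpoly \<Rightarrow> 'n cpoly" where
  "conj_cpoly = Poly_Mapping.map cnj"

lemma lookup_conj_cpoly [simp]: "Poly_Mapping.lookup (conj_cpoly p) m = cnj (Poly_Mapping.lookup p m)"
  by (simp add: conj_cpoly_def Poly_Mapping.map.rep_eq when_def)

lemma conj_cpoly_add: "conj_cpoly (p + q) = conj_cpoly p + conj_cpoly q"
  by (rule poly_mapping_eqI) (simp add: lookup_add)

lemma conj_cpoly_zero [simp]: "conj_cpoly 0 = 0"
  by (rule poly_mapping_eqI) simp

lemma eval_at_conj_cpoly: "eval_at u (conj_cpoly p) = cnj (eval_at u p)"
proof (induction p rule: poly_mapping_single_induct)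
  case (single m c)
  have "conj_cpoly (Poly_Mapping.single m c) = Poly_Mapping.single m (cnj c)"
    by (rule poly_mapping_eqI) (simp add: lookup_single when_def)
  then show ?case by (simp add: eval_at_single monom_val_def)
qed (simp_all add: conj_cpoly_add)

lemma pairing_conj_definite:
  assumes "pairing (conj_cpoly p) p = 0"
  shows "p = 0"
proof -
  have keys: "Poly_Mapping.keys (conj_cpoly p) = Poly_Mapping.keys p"
    by (auto simp: in_keys_iff)
  have "pairing (conj_cpoly p) p = (\<Sum>m\<in>Poly_Mapping.keys p.
      complex_of_real (real (monom_fact m) * (cmod (Poly_Mapping.lookup p m))\<^sup>2))"
    unfolding pairing_def linear_extension_def keys
    by (intro sum.cong) (auto simp: complex_norm_square simp flip: of_real_power)
  also have "\<dots> = complex_of_real (\<Sum>m\<in>Poly_Mapping.keys p.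
      real (monom_fact m) * (cmod (Poly_Mapping.lookup p m))\<^sup>2)"
    by simp
  finally have "(\<Sum>m\<in>Poly_Mapping.keys p. real (monom_fact m) * (cmod (Poly_Mapping.lookup p m))\<^sup>2) = 0"
    using assms of_real_eq_0_iff by metis
  then have "\<forall>m\<in>Poly_Mapping.keys p. real (monom_fact m) * (cmod (Poly_Mapping.lookup p m))\<^sup>2 = 0"
    by (subst (asm) sum_nonneg_eq_0_iff) auto
  then have "Poly_Mapping.lookup p m = 0" for m
    using monom_fact_pos[of m] by (cases "m \<in> Poly_Mapping.keys p") (auto simp: in_keys_iff)
  then show ?thesis by (intro poly_mapping_eqI) simp
qed

section \<open>Homogeneous parts\<close>

definition monom_degree :: "('n::finite \<Rightarrow>\<^sub>0 nat) \<Rightarrow> nat" where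
  "monom_degree m = (\<Sum>i\<in>UNIV. Poly_Mapping.lookup m i)"

lemma monom_degree_single_add: "monom_degree (Poly_Mapping.single i 1 + m) = Suc (monom_degree m)"
  by (simp add: monom_degree_def lookup_add sum.distrib lookup_single when_def)

lemma finite_monom_degree_eq: "finite {m :: 'n::finite \<Rightarrow>\<^sub>0 nat. monom_degree m = d}"
proof (rule inj_on_finite)
  show "inj_on Poly_Mapping.lookup {m :: 'n \<Rightarrow>\<^sub>0 nat. monom_degree m = d}"
    by (rule inj_onI) (simp add: lookup_inject)
  show "Poly_Mapping.lookup ` {m :: 'n \<Rightarrow>\<^sub>0 nat. monom_degree m = d} \<subseteq> (UNIV \<rightarrow>\<^sub>E {..d})"
    by (auto simp: monom_degree_def PiE_UNIV_domain intro: member_le_sum)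
  show "finite ((UNIV :: 'n set) \<rightarrow>\<^sub>E {..d})"
    by (intro finite_PiE) auto
qed

definition hom_part :: "nat \<Rightarrow> 'n::finite cpoly \<Rightarrow> 'n cpoly" where
  "hom_part d = linear_extension (\<lambda>m c. Poly_Mapping.single m c when monom_degree m = d)"

lemma hom_part_zero [simp]: "hom_part d 0 = 0"
  by (simp add: hom_part_def)

lemma hom_part_single:
  "hom_part d (Poly_Mapping.single m c) = (Poly_Mapping.single m c when monom_degree m = d)"
  by (simp add: hom_part_def linear_extension_single)

lemma hom_part_add: "hom_part d (p + q) = hom_part d p + hom_part d q"
  unfolding hom_part_def by (rule linear_extension_add) (simp_all add: when_def single_add)

lemma hom_part_sum: "hom_part d (sum f A) = (\<Sum>a\<in>A. hom_part d (f a))"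
  by (induction A rule: infinite_finite_induct) (simp_all add: hom_part_add)

lemma hom_part_scale: "hom_part d (cpoly_scale c p) = cpoly_scale c (hom_part d p)"
proof (induction p rule: poly_mapping_single_induct)
  case (single m e)
  then show ?case by (simp add: cpoly_scale_def mult_single hom_part_single when_def)
qed (simp_all add: hom_part_add cpoly.scale_right_distrib)

lemma hom_part_linear_form_mult:
  "hom_part d (linear_form h * p) = (case d of 0 \<Rightarrow> 0 | Suc e \<Rightarrow> linear_form h * hom_part e p)"
proof (induction p rule: poly_mapping_single_induct)
  case (single m c)
  show ?case
    unfolding linear_form_mult_single hom_part_sum hom_part_single monom_degree_single_add
    by (cases d) (simp_all add: linear_form_mult_single when_def del: One_nat_def)
next
  case zero
  show ?case by (cases d) simp_all
next
  case (add p q)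
  then show ?case by (cases d) (simp_all add: distrib_left hom_part_add)
qed

text \<open>Multiplication by a linear form shifts degrees by one. Only divisibility by the power
  matters later, so \<open>r\<close> stays unspecified; it is 0 when \<open>d\<close> is below
  \<open>k\<close>.\<close>

lemma hom_part_linear_form_power_mult:
  "\<exists>r. hom_part d (linear_form h ^ k * p) = linear_form h ^ k * r"
proof (induction k arbitrary: d)
  case 0
  show ?case unfolding power_0 mult_1 by blast
next
  case (Suc k)
  have step: "hom_part d (linear_form h ^ Suc k * p) =
      (case d of 0 \<Rightarrow> 0 | Suc e \<Rightarrow> linear_form h * hom_part e (linear_form h ^ k * p))"
    unfolding power_Suc mult.assoc by (rule hom_part_linear_form_mult)
  show ?case
  proof (cases d)
    case 0
    then have "hom_part d (linear_form h ^ Suc k * p) = linear_form h ^ Suc k * 0"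
      unfolding step by simp
    then show ?thesis by blast
  next
    case e: (Suc e)
    obtain r where "hom_part e (linear_form h ^ k * p) = linear_form h ^ k * r"
      using Suc by blast
    moreover have "hom_part d (linear_form h ^ Suc k * p) = linear_form h * hom_part e (linear_form h ^ k * p)"
      using step by (simp only: e nat.case)
    ultimately have "hom_part d (linear_form h ^ Suc k * p) = linear_form h ^ Suc k * r"
      by (simp only: power_Suc mult.assoc)
    then show ?thesis by blast
  qed
qed

lemma hom_part_form_prod: "hom_part d (form_prod Y) = (form_prod Y when size Y = d)"
proof (induction Y arbitrary: d)
  case empty
  have "hom_part d 1 = (1 when 0 = d)"
    using hom_part_single[of d 0 1] by (simp add: monom_degree_def)
  then show ?case by (simp add: form_prod_def)
next
  case (add y Y)
  have "form_prod (add_mset y Y) = linear_form y * form_prod Y"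
    by (simp add: form_prod_def)
  then show ?case
    by (cases d) (simp_all add: hom_part_linear_form_mult add when_def)
qed

text \<open>The cut-off depends on \<open>p\<close>; allowing every larger \<open>M\<close> lets the
  cut-offs of two summands be merged.\<close>

lemma hom_part_decomposition:
  "\<exists>N. \<forall>M\<ge>N. p = (\<Sum>d<M. hom_part d p)"
proof (induction p rule: poly_mapping_single_induct)
  case (single m c)
  have "Poly_Mapping.single m c = (\<Sum>d<M. hom_part d (Poly_Mapping.single m c))"
    if "M \<ge> Suc (monom_degree m)" for M
    using that by (simp add: hom_part_single when_def)
  then show ?case by blast
next
  case (add p q)
  then obtain N1 N2 where "\<forall>M\<ge>N1. p = (\<Sum>d<M. hom_part d p)" "\<forall>M\<ge>N2. q = (\<Sum>d<M. hom_part d q)"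
    by auto
  then have "\<forall>M\<ge>max N1 N2. p + q = (\<Sum>d<M. hom_part d (p + q))"
    unfolding hom_part_add sum.distrib by (metis max.bounded_iff)
  then show ?case by blast
qed simp

section \<open>Degrees along lines\<close>

definition nonorth_count :: "'a::real_inner multiset \<Rightarrow> 'a \<Rightarrow> nat" where
  "nonorth_count X h = size (filter_mset (\<lambda>x. x \<bullet> h \<noteq> 0) X)"

lemma nonorth_count_add_mset:
  "nonorth_count (add_mset x X) h = nonorth_count X h + (if x \<bullet> h \<noteq> 0 then 1 else 0)"
  by (simp add: nonorth_count_def)

lemma line_poly_linear_form_mult:
  "line_poly a h (linear_form y * p) =
     [:complex_of_real (y \<bullet> a), complex_of_real (y \<bullet> h):] * line_poly a h p"
  by (rule line_poly_eqI) (simp add: poly_line_poly inner_add_right distrib_right)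

lemma line_poly_scale: "line_poly a h (cpoly_scale c p) = smult c (line_poly a h p)"
  by (rule line_poly_eqI) (simp add: poly_line_poly)

text \<open>Each factor restricts to a polynomial of degree at most one, and to a constant when its
  vector is orthogonal to \<open>h\<close>.\<close>

lemma degree_line_poly_form_prod:
  "degree (line_poly a h (form_prod Y)) \<le> nonorth_count Y h"
proof (induction Y)
  case empty
  have "line_poly a h (1 :: 'a cpoly) = 1"
    by (rule line_poly_eqI) simp
  then show ?case by (simp add: form_prod_def)
next
  case (add y Y)
  have "form_prod (add_mset y Y) = linear_form y * form_prod Y"
    by (simp add: form_prod_def)
  then have "degree (line_poly a h (form_prod (add_mset y Y))) \<le>
      degree [:complex_of_real (y \<bullet> a), complex_of_real (y \<bullet> h):] +
      degree (line_poly a h (form_prod Y))"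
    by (simp only: line_poly_linear_form_mult degree_mult_le)
  also have "\<dots> \<le> (if y \<bullet> h \<noteq> 0 then 1 else 0) + nonorth_count Y h"
    using add by auto
  finally show ?case
    by (simp only: nonorth_count_add_mset add.commute)
qed

section \<open>Closure properties and degree bounds of \<open>P_plus\<close>\<close>

lemma P_plus_induct [consumes 1, case_names zero add scale prod]:
  assumes "p \<in> P_plus X"
    and "Q 0"
    and "\<And>p q. Q p \<Longrightarrow> Q q \<Longrightarrow> Q (p + q)"
    and "\<And>c p. Q p \<Longrightarrow> Q (cpoly_scale c p)"
    and "\<And>Y. Y \<subseteq># X \<Longrightarrow> Q (form_prod Y)"
  shows "Q p"
  using assms(1) unfolding P_plus_def
proof (induction rule: cpoly.span_induct)
  case base
  then show ?case using assms by (auto simp: cpoly.subspace_def)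
next
  case (step p)
  then show ?case using assms by auto
qed

lemma degree_line_poly_P_plus:
  assumes "p \<in> P_plus X"
  shows "degree (line_poly a h p) \<le> nonorth_count X h"
  using assms
proof (induction rule: P_plus_induct)
  case (scale c p)
  then show ?case by (simp add: line_poly_scale)
next
  case (prod Y)
  then have "nonorth_count Y h \<le> nonorth_count X h"
    unfolding nonorth_count_def by (intro size_mset_mono multiset_filter_mono)
  then show ?case using degree_line_poly_form_prod order_trans by blast
qed (simp_all add: degree_add_le)

lemma form_prod_in_P_plus: "Y \<subseteq># X \<Longrightarrow> form_prod Y \<in> P_plus X"
  unfolding P_plus_def by (intro cpoly.span_base) auto

lemma subspace_P_plus: "cpoly.subspace (P_plus X)"
  by (simp add: P_plus_def)

lemma P_plus_mono: "X' \<subseteq># X \<Longrightarrow> P_plus X' \<subseteq> P_plus X"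
  unfolding P_plus_def using subset_mset.order_trans by (intro cpoly.span_mono) blast

lemma linear_form_mult_P_plus:
  assumes "p \<in> P_plus X"
  shows "linear_form x * p \<in> P_plus (add_mset x X)"
  using assms
proof (induction rule: P_plus_induct)
  case zero
  then show ?case using cpoly.subspace_0[OF subspace_P_plus] by simp
next
  case (add p q)
  then show ?case using cpoly.subspace_add[OF subspace_P_plus] by (simp add: distrib_left)
next
  case (scale c p)
  have "linear_form x * cpoly_scale c p = cpoly_scale c (linear_form x * p)"
    unfolding cpoly_scale_def by (simp only: mult.left_commute)
  then show ?case using scale cpoly.subspace_scale[OF subspace_P_plus] by simp
next
  case (prod Y)
  have "form_prod (add_mset x Y) = linear_form x * form_prod Y"
    by (simp add: form_prod_def)
  then show ?case using prod form_prod_in_P_plus[of "add_mset x Y" "add_mset x X"] by simp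
qed

text \<open>Division with remainder by the linear form of \<open>x\<close>: the remainder is
  \<open>p\<close> composed with a map that, when \<open>x \<bullet> v = 1\<close>, is the
  projection along \<open>v\<close> onto the hyperplane of \<open>x\<close>.\<close>

lemma eval_at_expand_along:
  fixes p :: "'n::finite cpoly"
  shows "\<exists>g. \<forall>u. eval_at u p = eval_at (u - (x \<bullet> u) *\<^sub>R v) p + complex_of_real (x \<bullet> u) * eval_at u g"
proof (induction p rule: cpoly_ring_induct)
  case (const c)
  show ?case by (rule exI[of _ 0]) simp
next
  case (var i)
  show ?case
    by (rule exI[of _ "Poly_Mapping.single 0 (complex_of_real (v $ i))"])
      (simp add: eval_at_single del: One_nat_def)
next
  case (add p q)
  then obtain g g' where
    "\<And>u. eval_at u p = eval_at (u - (x \<bullet> u) *\<^sub>R v) p + complex_of_real (x \<bullet> u) * eval_at u g"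
    "\<And>u. eval_at u q = eval_at (u - (x \<bullet> u) *\<^sub>R v) q + complex_of_real (x \<bullet> u) * eval_at u g'"
    by blast
  then have "eval_at u (p + q) = eval_at (u - (x \<bullet> u) *\<^sub>R v) (p + q) +
      complex_of_real (x \<bullet> u) * eval_at u (g + g')" for u
    unfolding eval_at_add by (metis (no_types, lifting) add.assoc add.commute distrib_left)
  then show ?case by blast
next
  case (mult p q)
  then obtain g g' where g:
    "\<And>u. eval_at u p = eval_at (u - (x \<bullet> u) *\<^sub>R v) p + complex_of_real (x \<bullet> u) * eval_at u g"
    "\<And>u. eval_at u q = eval_at (u - (x \<bullet> u) *\<^sub>R v) q + complex_of_real (x \<bullet> u) * eval_at u g'"
    by blast
  \<comment> \<open>The term with \<open>g * g'\<close> is counted by both \<open>g * q\<close> and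
    \<open>p * g'\<close>, hence the subtraction.\<close>
  have "eval_at u (p * q) = eval_at (u - (x \<bullet> u) *\<^sub>R v) (p * q) +
      complex_of_real (x \<bullet> u) * eval_at u (g * q + p * g' - linear_form x * g * g')" for u
  proof -
    define P Q G G' s where "P = eval_at (u - (x \<bullet> u) *\<^sub>R v) p" "Q = eval_at (u - (x \<bullet> u) *\<^sub>R v) q"
      "G = eval_at u g" "G' = eval_at u g'" "s = complex_of_real (x \<bullet> u)"
    have "(P + s * G) * (Q + s * G') = P * Q + s * (G * (Q + s * G') + (P + s * G) * G' - s * G * G')"
      by algebra
    then show ?thesis
      using g[of u] unfolding eval_at_mult eval_at_add eval_at_diff eval_at_linear_form
        P_Q_G_G'_s_def by metis
  qed
  then show ?case by blast
qed

text \<open>If \<open>x\<close> is not orthogonal to \<open>h\<close>, its form has degree one on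
  each line and division lowers the degree by one. Otherwise the form is constant on the line, and
  may be the constant 0.\<close>

lemma degree_line_poly_divide:
  assumes U: "subspace U" "h \<in> U" "v \<in> U" and v: "x \<bullet> v = 1"
    and f: "\<And>u. u \<in> U \<Longrightarrow> eval_at u f = complex_of_real (x \<bullet> u) * eval_at u g"
    and deg: "\<And>a. a \<in> U \<Longrightarrow> degree (line_poly a h f) \<le> k + (if x \<bullet> h \<noteq> 0 then 1 else 0)"
    and a: "a \<in> U"
  shows "degree (line_poly a h g) \<le> k"
proof -
  have line: "line_poly a h f = [:complex_of_real (x \<bullet> a), complex_of_real (x \<bullet> h):] * line_poly a h g"
    if "a \<in> U" for a
    by (rule line_poly_eqI)
      (use U that in \<open>simp add: f subspace_add subspace_scale poly_line_poly inner_add_right distrib_right\<close>)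
  show ?thesis
  proof (cases "x \<bullet> h = 0")
    case False
    show ?thesis
    proof (cases "line_poly a h g = 0")
      case nz: False
      then show ?thesis
        using deg[OF a] False unfolding line[OF a] by (subst (asm) degree_mult_eq) auto
    qed simp
  next
    case True
    \<comment> \<open>Only base points off the hyperplane of \<open>x\<close> are covered by division; the rest follow by density.\<close>
    define w where "w = (dir_deriv h ^^ Suc k) g"
    have off: "eval_at b w = 0" if b: "b \<in> U" "x \<bullet> b \<noteq> 0" for b
    proof -
      have "degree (line_poly b h g) \<le> k"
        using deg[OF b(1)] b(2) True unfolding line[OF b(1)] by simp
      then have "line_poly b h w = 0"
        unfolding w_def line_poly_dir_deriv_funpow funpow_pderiv_eq_0_iff .
      then show ?thesis using poly_line_poly[of b h w 0] by simp
    qed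
    have "eval_at b w = 0" if b: "b \<in> U" for b
    proof -
      have "line_poly b v w = 0"
      \<comment> \<open>Since \<open>x \<bullet> v = 1\<close>, the line through \<open>b\<close>
        along \<open>v\<close> meets the hyperplane of \<open>x\<close> only at this
        parameter.\<close>
      proof (rule complex_poly_eqI_cofinite_real[of "{- (x \<bullet> b)}"])
        fix t assume "t \<notin> {- (x \<bullet> b)}"
        then have "x \<bullet> (b + t *\<^sub>R v) \<noteq> 0"
          using v by (simp add: inner_add_right)
        then show "poly (line_poly b v w) (complex_of_real t) = poly 0 (complex_of_real t)"
          using U b by (simp add: poly_line_poly off subspace_add subspace_scale)
      qed simp
      then show ?thesis using poly_line_poly[of b v w 0] by simp
    qed
    then show ?thesis
      using degree_line_poly_le_iff[OF U(1,2), of g k] a unfolding w_def by blast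
  qed
qed

section \<open>Deletion and contraction\<close>

text \<open>
  Vectors of \<open>X\<close> are viewed as functionals on \<open>U\<close>: \<open>separates\<close> says that they span the dual of \<open>U\<close>,
  and the facet normals are the directions whose annihilator in \<open>X\<close> has corank one there.
\<close>

definition separates :: "'a::real_inner multiset \<Rightarrow> 'a set \<Rightarrow> bool" where
  "separates X U \<longleftrightarrow> (\<forall>u\<in>U. (\<forall>x\<in>#X. x \<bullet> u = 0) \<longrightarrow> u = 0)"

definition facet_normal :: "'a::real_inner multiset \<Rightarrow> 'a set \<Rightarrow> 'a \<Rightarrow> bool" where
  "facet_normal X U h \<longleftrightarrow>
     h \<in> U \<and> h \<noteq> 0 \<and> (\<forall>u\<in>U. (\<forall>x\<in>#X. x \<bullet> h = 0 \<longrightarrow> x \<bullet> u = 0) \<longrightarrow> u \<in> span {h})"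

text \<open>Contraction is expressed by shrinking \<open>U\<close> while the vectors stay in the
  ambient space, so one induction on \<open>X\<close> with \<open>U\<close> and \<open>f\<close>
  arbitrary serves deletion and contraction alike.\<close>

lemma P_plus_of_facet_degrees:
  fixes X :: "(real ^ 'n::finite) multiset"
  assumes "subspace U" "separates X U"
    and "\<And>h a. facet_normal X U h \<Longrightarrow> a \<in> U \<Longrightarrow> degree (line_poly a h f) \<le> nonorth_count X h"
  shows "\<exists>g\<in>P_plus X. \<forall>u\<in>U. eval_at u f = eval_at u g"
  using assms
proof (induction X arbitrary: U f)
  case empty
  \<comment> \<open>With no vectors left, separation makes \<open>U\<close> trivial, so the constant
    \<open>eval_at 0 f\<close> agrees with \<open>f\<close> on it.\<close>
  have "U \<subseteq> {0}" using empty by (auto simp: separates_def)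
  moreover have "cpoly_scale (eval_at 0 f) (form_prod {#}) \<in> P_plus {#}"
    by (intro cpoly.subspace_scale[OF subspace_P_plus] form_prod_in_P_plus) simp
  ultimately show ?case
    by (intro bexI[of _ "cpoly_scale (eval_at 0 f) (form_prod {#})"]) (auto simp: form_prod_def)
next
  case (add x X)
  note U = \<open>subspace U\<close> and sep = \<open>separates (add_mset x X) U\<close>
    and deg = add.prems(3)
  have mono: "P_plus X \<subseteq> P_plus (add_mset x X)"
    by (rule P_plus_mono) simp
  show ?case
  proof (cases "\<forall>u\<in>U. x \<bullet> u = 0")
    case True
    \<comment> \<open>Here \<open>x\<close> vanishes on \<open>U\<close>, so dropping it changes
      neither separation, nor the facet normals, nor their counts.\<close>
    have "separates X U" using sep True by (auto simp: separates_def)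
    moreover have "degree (line_poly a h f) \<le> nonorth_count X h" if "facet_normal X U h" "a \<in> U" for a h
    proof -
      have "facet_normal (add_mset x X) U h" "x \<bullet> h = 0"
        using that True by (auto simp: facet_normal_def)
      then show ?thesis using deg[OF _ that(2), of h] by (simp add: nonorth_count_add_mset)
    qed
    ultimately obtain g where "g \<in> P_plus X" "\<forall>u\<in>U. eval_at u f = eval_at u g"
      using add.IH[OF U] by blast
    then show ?thesis using mono by blast
  next
    case False
    then obtain v0 where v0: "v0 \<in> U" "x \<bullet> v0 \<noteq> 0" by blast
    define v where "v = (1 / (x \<bullet> v0)) *\<^sub>R v0"
    have v: "v \<in> U" "x \<bullet> v = 1"
      using v0 U by (auto simp: v_def subspace_scale)
    define U' where "U' = {u\<in>U. x \<bullet> u = 0}"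
    have U': "subspace U'"
      using U by (auto simp: U'_def subspace_def inner_add_right)
    have sep': "separates X U'"
      using sep by (auto simp: separates_def U'_def)
    \<comment> \<open>As \<open>x\<close> is orthogonal to \<open>h\<close>, the annihilator
      condition for the enlarged multiset already forces \<open>u\<close> into \<open>U'\<close>.
      For the same reason the counts agree.\<close>
    have facet: "facet_normal (add_mset x X) U h" "h \<in> U" "x \<bullet> h = 0" if "facet_normal X U' h" for h
      using that by (auto simp: facet_normal_def U'_def)
    have "degree (line_poly a h f) \<le> nonorth_count X h" if "facet_normal X U' h" "a \<in> U'" for a h
      using deg[OF facet(1)[OF that(1)], of a] facet(3)[OF that(1)] that(2)
      by (simp add: nonorth_count_add_mset U'_def)
    then obtain g' where g': "g' \<in> P_plus X" "\<forall>u\<in>U'. eval_at u f = eval_at u g'"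
      using add.IH[OF U' sep', of f] by blast
    obtain g where g: "\<And>u. eval_at u (f - g') =
        eval_at (u - (x \<bullet> u) *\<^sub>R v) (f - g') + complex_of_real (x \<bullet> u) * eval_at u g"
      using eval_at_expand_along[of "f - g'" x v] by blast
    have quot: "eval_at u (f - g') = complex_of_real (x \<bullet> u) * eval_at u g" if "u \<in> U" for u
    proof -
      have "u - (x \<bullet> u) *\<^sub>R v \<in> U'"
        using that U v by (auto simp: U'_def subspace_diff subspace_scale inner_diff_right)
      then have "eval_at (u - (x \<bullet> u) *\<^sub>R v) (f - g') = 0" using g' by simp
      with g[of u] show ?thesis by simp
    qed
    \<comment> \<open>Both \<open>f\<close> and \<open>g'\<close> obey the bound for
      \<open>add_mset x X\<close>, hence so does the dividend; division by the form of
      \<open>x\<close> brings it down to the bound for \<open>X\<close>.\<close>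
    have deg_g: "degree (line_poly a h g) \<le> nonorth_count X h"
      if h: "facet_normal (add_mset x X) U h" "a \<in> U" for a h
    proof (rule degree_line_poly_divide[OF U _ v(1,2) quot _ h(2)])
      show "h \<in> U" using h by (simp add: facet_normal_def)
      fix b assume b: "b \<in> U"
      have "line_poly b h (f - g') = line_poly b h f - line_poly b h g'"
        by (rule line_poly_eqI) (simp add: poly_line_poly)
      moreover have "degree (line_poly b h g') \<le> nonorth_count (add_mset x X) h"
        by (rule degree_line_poly_P_plus) (use g' mono in blast)
      ultimately have "degree (line_poly b h (f - g')) \<le> nonorth_count (add_mset x X) h"
        using deg[OF h(1) b] by (simp add: degree_diff_le)
      then show "degree (line_poly b h (f - g')) \<le> nonorth_count X h + (if x \<bullet> h \<noteq> 0 then 1 else 0)"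
        by (simp only: nonorth_count_add_mset)
    qed
    have "\<exists>g''\<in>P_plus X. \<forall>u\<in>U. eval_at u g = eval_at u g''"
    proof (cases "separates X U")
      case True
      \<comment> \<open>More vectors put more conditions on \<open>u\<close>, so a facet normal for
        \<open>X\<close> remains one.\<close>
      have "facet_normal (add_mset x X) U h" if "facet_normal X U h" for h
        using that by (auto simp: facet_normal_def)
      then show ?thesis using add.IH[OF U True, of g] deg_g by blast
    next
      case False
      \<comment> \<open>\<open>x\<close> is a coloop: \<open>e\<close> is a facet normal with count one, so \<open>g\<close> is constant along \<open>e\<close>.\<close>
      then obtain e where e: "e \<in> U" "e \<noteq> 0" "\<forall>y\<in>#X. y \<bullet> e = 0"
        by (auto simp: separates_def)
      then have xe: "x \<bullet> e \<noteq> 0"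
        using sep by (auto simp: separates_def)
      have e_facet: "facet_normal (add_mset x X) U e"
        unfolding facet_normal_def
      proof (intro conjI ballI impI e(1,2))
        fix u assume u: "u \<in> U" "\<forall>y\<in>#add_mset x X. y \<bullet> e = 0 \<longrightarrow> y \<bullet> u = 0"
        define c where "c = (x \<bullet> u) / (x \<bullet> e)"
        have "u - c *\<^sub>R e \<in> U" "\<forall>y\<in>#add_mset x X. y \<bullet> (u - c *\<^sub>R e) = 0"
          using u e xe U by (auto simp: c_def subspace_diff subspace_scale inner_diff_right)
        then have "u - c *\<^sub>R e = 0"
          using sep unfolding separates_def by blast
        then show "u \<in> span {e}" by (auto simp: span_singleton)
      qed
      have e_count: "nonorth_count X e = 0"
        using e(3) by (simp add: nonorth_count_def)
      have const: "eval_at (b + t *\<^sub>R e) p = eval_at b p" if deg0: "degree (line_poly b e p) \<le> 0" for b t p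
      proof -
        obtain c where "line_poly b e p = [:c:]"
          using deg0 degree_eq_zeroE by blast
        then show ?thesis
          using poly_line_poly[of b e p t] poly_line_poly[of b e p 0] by simp
      qed
      have "degree (line_poly a h g) \<le> nonorth_count X h" if "facet_normal X U' h" "a \<in> U'" for a h
        using deg_g[OF facet(1)[OF that(1)], of a] that(2) by (simp add: U'_def)
      then obtain g'' where g'': "g'' \<in> P_plus X" "\<forall>u\<in>U'. eval_at u g = eval_at u g''"
        using add.IH[OF U' sep', of g] by blast
      have "eval_at u g = eval_at u g''" if u: "u \<in> U" for u
      proof -
        \<comment> \<open>Subtracting \<open>t *\<^sub>R e\<close> moves \<open>u\<close> into
          \<open>U'\<close>, where \<open>g\<close> and \<open>g''\<close> agree; both are constant
          along \<open>e\<close>, because the count of \<open>e\<close> in \<open>X\<close> is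
          zero.\<close>
        define t where "t = (x \<bullet> u) / (x \<bullet> e)"
        define b where "b = u - t *\<^sub>R e"
        have b: "b \<in> U'"
          using u e(1) U xe by (auto simp: b_def t_def U'_def subspace_diff subspace_scale inner_diff_right)
        have ub: "u = b + t *\<^sub>R e" by (simp add: b_def)
        have "degree (line_poly b e g) \<le> 0"
          using deg_g[OF e_facet, of b] b e_count by (simp add: U'_def)
        moreover have "degree (line_poly b e g'') \<le> 0"
          using degree_line_poly_P_plus[OF g''(1), of b e] e_count by simp
        ultimately show ?thesis
          unfolding ub using const g''(2) b by metis
      qed
      then show ?thesis using g''(1) by blast
    qed
    then obtain g'' where g'': "g'' \<in> P_plus X" "\<forall>u\<in>U. eval_at u g = eval_at u g''"
      by blast
    have "g' + linear_form x * g'' \<in> P_plus (add_mset x X)"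
      using g'(1) g''(1) mono by (intro cpoly.subspace_add[OF subspace_P_plus] linear_form_mult_P_plus) auto
    moreover have "eval_at u f = eval_at u (g' + linear_form x * g'')" if "u \<in> U" for u
      using quot[OF that] g''(2) that by (simp add: algebra_simps del: ideal.scale_scale)
    ultimately show ?thesis by blast
  qed
qed

section \<open>The direct sum decomposition\<close>

lemma separates_UNIV_of_full_rank:
  fixes X :: "(real ^ 'n::finite) multiset"
  assumes "dim (set_mset X) = CARD('n)"
  shows "separates X UNIV"
  unfolding separates_def
proof (intro ballI impI)
  fix u :: "real ^ 'n"
  assume "\<forall>x\<in>#X. x \<bullet> u = 0"
  then have "orthogonal u y" if "y \<in> span (set_mset X)" for y
    using that orthogonal_to_span by (metis orthogonal_def inner_commute)
  moreover have "span (set_mset X) = UNIV"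
    using assms dim_eq_full[of "set_mset X"] by simp
  ultimately show "u = 0"
    using orthogonal_self by blast
qed

text \<open>Split a vector of \<open>K\<close> into a part in \<open>span S\<close> and a part
  \<open>z\<close> orthogonal to \<open>S\<close>. The facet condition makes \<open>z\<close> a
  multiple of \<open>h\<close>, yet \<open>z\<close> lies in \<open>K\<close>, so it is 0.\<close>

lemma facet_normal_imp_facet_hyperplane:
  fixes X :: "(real ^ 'n::finite) multiset"
  assumes "facet_normal X UNIV h"
  shows "{x. h \<bullet> x = 0} \<in> facet_hyperplanes X"
proof -
  define K where "K = {x. h \<bullet> x = 0}"
  define S where "S = set_mset X \<inter> K"
  have facet: "u \<in> span {h}" if "\<forall>x\<in>S. x \<bullet> u = 0" for u
    using assms that by (auto simp: facet_normal_def S_def K_def inner_commute)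
  have K: "subspace K" by (simp add: K_def subspace_hyperplane)
  have "K \<subseteq> span S"
  proof
    fix k assume k: "k \<in> K"
    obtain s z where sz: "s \<in> span S" "\<And>w. w \<in> span S \<Longrightarrow> orthogonal z w" "k = s + z"
      using orthogonal_subspace_decomp_exists[of S k] by blast
    have "\<forall>x\<in>S. x \<bullet> z = 0"
      using sz(2) span_base by (metis orthogonal_def inner_commute)
    then obtain c where c: "z = c *\<^sub>R h"
      using facet by (auto simp: span_singleton)
    have "s \<in> K"
      using sz(1) K S_def by (metis Int_lower2 span_minimal subsetD)
    then have "h \<bullet> z = 0"
      using k sz(3) by (auto simp: K_def inner_add_right)
    then have "z = 0"
      by (auto simp: c)
    then show "k \<in> span S" using sz by simp
  qed
  moreover have "span S \<subseteq> K"
    using K by (intro span_minimal) (auto simp: S_def)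
  ultimately have "span (set_mset X \<inter> K) = K"
    unfolding S_def by (rule equalityI[rotated])
  moreover have "dim K = CARD('n) - 1"
    using assms dim_hyperplane[of h] by (simp add: K_def facet_normal_def)
  ultimately show ?thesis
    using K unfolding facet_hyperplanes_def K_def[symmetric] by blast
qed

lemma linear_form_scaleR: "linear_form (c *\<^sub>R y) = Poly_Mapping.single 0 (complex_of_real c) * linear_form y"
  by (rule eval_at_inject) simp

text \<open>The chosen normal of the hyperplane orthogonal to \<open>h\<close> is a nonzero multiple
  of \<open>h\<close>, and the ideal absorbs the scalar.\<close>

lemma linear_form_power_in_I_plus:
  fixes X :: "(real ^ 'n::finite) multiset"
  assumes "normal_choice X \<eta>" "facet_normal X UNIV h"
  shows "linear_form h ^ Suc (nonorth_count X h) \<in> I_plus X \<eta>"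
proof -
  define K where "K = {x. h \<bullet> x = 0}"
  have K: "K \<in> facet_hyperplanes X"
    using facet_normal_imp_facet_hyperplane[OF assms(2)] by (simp add: K_def)
  have \<eta>: "\<eta> K \<noteq> 0" "\<forall>x\<in>K. \<eta> K \<bullet> x = 0"
    using assms(1) K by (auto simp: normal_choice_def)
  then have "\<forall>x\<in>#X. x \<bullet> h = 0 \<longrightarrow> x \<bullet> \<eta> K = 0"
    by (auto simp: K_def inner_commute)
  then have "\<eta> K \<in> span {h}"
    using assms(2) by (auto simp: facet_normal_def)
  then obtain c where c: "\<eta> K = c *\<^sub>R h"
    by (auto simp: span_singleton)
  with \<eta>(1) have "h = (1 / c) *\<^sub>R \<eta> K"
    by auto
  then have power: "linear_form h ^ Suc (nonorth_count X h) =
      Poly_Mapping.single 0 (complex_of_real (1 / c)) ^ Suc (nonorth_count X h) *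
      linear_form (\<eta> K) ^ Suc (nonorth_count X h)"
    by (metis linear_form_scaleR power_mult_distrib)
  have count: "off_count X K = nonorth_count X h"
    by (simp add: off_count_def nonorth_count_def K_def inner_commute)
  have "linear_form (\<eta> K) ^ (off_count X K + 1) \<in> I_plus X \<eta>"
    unfolding I_plus_def using K by (intro ideal.span_base) blast
  then show ?thesis
    unfolding power unfolding count Suc_eq_plus1 I_plus_def by (rule ideal.span_scale)
qed

lemma pairing_I_plus_P_plus:
  fixes X :: "(real ^ 'n::finite) multiset"
  assumes "normal_choice X \<eta>" "i \<in> I_plus X \<eta>" "p \<in> P_plus X"
  shows "pairing i p = 0"
proof -
  \<comment> \<open>Quantifying over all multiples makes the property closed under ring
    multiplication, as induction over the ideal demands.\<close>
  have "\<forall>q. pairing (q * i) p = 0"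
    using assms(2) unfolding I_plus_def
  proof (induction rule: ideal.span_induct)
    case base
    show ?case
    proof (rule ideal.subspaceI)
      fix c x assume "x \<in> {x. \<forall>q. pairing (q * x) p = 0}"
      then show "c * x \<in> {x. \<forall>q. pairing (q * x) p = 0}"
        unfolding mem_Collect_eq mult.assoc[symmetric] by blast
    qed (simp_all add: distrib_left pairing_add_left)
  next
    case (step x)
    then obtain H where H: "H \<in> facet_hyperplanes X" "x = linear_form (\<eta> H) ^ Suc (off_count X H)"
      by auto
    \<comment> \<open>Vectors of \<open>X\<close> in \<open>H\<close> are orthogonal to its normal.
      So \<open>p\<close> has degree at most \<open>m(H)\<close> along it, and
      \<open>m(H) + 1\<close> derivatives kill \<open>p\<close>.\<close>
    have "nonorth_count X (\<eta> H) \<le> off_count X H"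
      unfolding nonorth_count_def off_count_def
      using assms(1) H(1)
      by (intro size_mset_mono mset_subset_eqI) (auto simp: normal_choice_def inner_commute)
    then have "\<forall>a\<in>UNIV. degree (line_poly a (\<eta> H) p) \<le> off_count X H"
      using degree_line_poly_P_plus[OF assms(3)] order_trans by blast
    then have "(dir_deriv (\<eta> H) ^^ Suc (off_count X H)) p = 0"
      using degree_line_poly_le_iff[of UNIV "\<eta> H" p "off_count X H"] eval_at_eq_0_imp_zero by auto
    then show ?case
      unfolding H(2) using pairing_linear_form_power_mult[of "\<eta> H" "Suc (off_count X H)" _ p]
      by (metis mult.commute pairing_zero_right)
  qed
  from this[rule_format, of 1] show ?thesis by simp
qed

text \<open>The vectors of \<open>X\<close> are real, so conjugation fixes the spanning
  products.\<close>

lemma conj_cpoly_P_plus: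
  assumes "p \<in> P_plus X"
  shows "conj_cpoly p \<in> P_plus X"
  using assms
proof (induction rule: P_plus_induct)
  case zero
  then show ?case using cpoly.subspace_0[OF subspace_P_plus] by simp
next
  case (add p q)
  then show ?case using cpoly.subspace_add[OF subspace_P_plus] by (simp add: conj_cpoly_add)
next
  case (scale c p)
  have "conj_cpoly (cpoly_scale c p) = cpoly_scale (cnj c) (conj_cpoly p)"
    by (rule eval_at_inject) (simp add: eval_at_conj_cpoly)
  then show ?case using scale cpoly.subspace_scale[OF subspace_P_plus] by simp
next
  case (prod Y)
  have "conj_cpoly (form_prod Y) = form_prod Y"
    by (rule eval_at_inject) (simp add: eval_at_conj_cpoly eval_at_form_prod)
  then show ?case using prod form_prod_in_P_plus by simp
qed

text \<open>Extend a basis of \<open>S\<close> by \<open>x\<close> and prescribe the values 0 on the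
  basis and 1 at \<open>x\<close>.\<close>

lemma separating_functional:
  assumes "cpoly.subspace S" "x \<notin> S"
  obtains \<phi> where "Vector_Spaces.linear cpoly_scale (*) \<phi>" "\<And>s. s \<in> S \<Longrightarrow> \<phi> s = 0" "\<phi> x = (1::complex)"
proof -
  interpret vp: vector_space_pair
    "cpoly_scale :: complex \<Rightarrow> 'a cpoly \<Rightarrow> 'a cpoly"
    "(*) :: complex \<Rightarrow> complex \<Rightarrow> complex"
    by unfold_locales (simp_all add: distrib_left distrib_right)
  obtain B where B: "B \<subseteq> S" "cpoly.independent B" "S \<subseteq> cpoly.span B"
    using cpoly.maximal_independent_subset by blast
  have span: "cpoly.span B = S"
    using B assms(1) cpoly.span_minimal by blast
  then have "cpoly.independent (insert x B)"
    using B(2) assms(2) by (simp add: cpoly.independent_insertI)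
  then obtain \<phi> where \<phi>: "Vector_Spaces.linear cpoly_scale (*) \<phi>"
    "\<forall>y\<in>insert x B. \<phi> y = (if y = x then 1 else 0)"
    using vp.linear_independent_extend[of "insert x B" "\<lambda>y. if y = x then 1 else 0"] by blast
  interpret l: Vector_Spaces.linear cpoly_scale "(*)" \<phi> by fact
  have "\<phi> s = 0" if "s \<in> cpoly.span B" for s
    using that
  proof (induction rule: cpoly.span_induct)
    case base
    show ?case by (auto simp: cpoly.subspace_def l.add l.scale)
  next
    case (step y)
    then show ?case using \<phi>(2) B(1) assms(2) by auto
  qed
  then show ?thesis using that[OF \<phi>(1)] \<phi>(2) span by auto
qed

text \<open>A functional on all polynomials need not come from a polynomial, but there are finitely
  many monomials of degree \<open>d\<close>. Dividing by \<open>monom_fact m\<close> cancels the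
  weight in the pairing.\<close>

lemma functional_hom_part_eq_pairing:
  fixes \<phi> :: "'n::finite cpoly \<Rightarrow> complex"
  assumes "Vector_Spaces.linear cpoly_scale (*) \<phi>"
  obtains f where "\<And>q. pairing q f = \<phi> (hom_part d q)"
proof -
  interpret l: Vector_Spaces.linear cpoly_scale "(*)" \<phi> by fact
  define f where "f = (\<Sum>m | monom_degree m = d.
      Poly_Mapping.single m (\<phi> (Poly_Mapping.single m 1) / of_nat (monom_fact m)))"
  have lookup_f: "Poly_Mapping.lookup f m =
      (\<phi> (Poly_Mapping.single m 1) / of_nat (monom_fact m) when monom_degree m = d)" for m
    unfolding f_def lookup_sum lookup_single
    by (simp add: when_def finite_monom_degree_eq)
  have "pairing q f = \<phi> (hom_part d q)" for q
  proof (induction q rule: poly_mapping_single_induct)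
    case (single m c)
    have "Poly_Mapping.single m c = cpoly_scale c (Poly_Mapping.single m 1)"
      by (simp add: cpoly_scale_def mult_single)
    then have "\<phi> (Poly_Mapping.single m c) = c * \<phi> (Poly_Mapping.single m 1)"
      by (simp add: l.scale)
    then show ?case
      using monom_fact_pos[of m]
      by (simp add: pairing_single_left hom_part_single lookup_f when_def l.zero)
  qed (simp_all add: l.zero l.add hom_part_add pairing_add_left)
  then show ?thesis by (rule that)
qed

lemma subspace_I_plus: "cpoly.subspace (I_plus X \<eta>)"
  unfolding I_plus_def
  by (rule cpoly.subspaceI)
    (simp_all only: cpoly_scale_def ideal.span_zero ideal.span_add ideal.span_scale)

lemma P_plus_add_I_plus:
  fixes X :: "(real ^ 'n::finite) multiset"
  assumes "separates X UNIV" "normal_choice X \<eta>"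
  shows "\<exists>u\<in>P_plus X. \<exists>w\<in>I_plus X \<eta>. x = u + w"
proof (rule ccontr)
  assume no: "\<not> ?thesis"
  define S where "S = {u + w |u w. u \<in> P_plus X \<and> w \<in> I_plus X \<eta>}"
  have "cpoly.subspace S"
    unfolding S_def by (rule cpoly.subspace_sums[OF subspace_P_plus subspace_I_plus])
  moreover have "x \<notin> S" using no by (auto simp: S_def)
  ultimately obtain \<phi> where \<phi>: "Vector_Spaces.linear cpoly_scale (*) \<phi>"
    "\<And>s. s \<in> S \<Longrightarrow> \<phi> s = 0" "\<phi> x = (1::complex)"
    using separating_functional by blast
  interpret l: Vector_Spaces.linear cpoly_scale "(*)" \<phi> by fact
  have P: "\<phi> u = 0" if "u \<in> P_plus X" for u
  proof -
    have "u + 0 \<in> S" unfolding S_def using that cpoly.subspace_0[OF subspace_I_plus] by blast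
    then show ?thesis using \<phi>(2) by simp
  qed
  have I: "\<phi> w = 0" if "w \<in> I_plus X \<eta>" for w
  proof -
    have "0 + w \<in> S" unfolding S_def using that cpoly.subspace_0[OF subspace_P_plus] by blast
    then show ?thesis using \<phi>(2) by simp
  qed
  \<comment> \<open>This suffices, as \<open>x\<close> is a finite sum of homogeneous parts; in a
    single degree \<open>\<phi>\<close> is represented by a polynomial.\<close>
  have "\<phi> (hom_part d q) = 0" for d q
  proof -
    obtain f where f: "\<And>q. pairing q f = \<phi> (hom_part d q)"
      using functional_hom_part_eq_pairing[OF \<phi>(1)] by blast
    have "degree (line_poly a h f) \<le> nonorth_count X h" if h: "facet_normal X UNIV h" for a h
    proof -
      have "(dir_deriv h ^^ Suc (nonorth_count X h)) f = 0"
      proof (rule pairing_nondegenerate)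
        fix q
        \<comment> \<open>Adjointness moves the derivatives onto \<open>q\<close>; the homogeneous
          part of the resulting multiple is again a multiple of the power, so it lies in the ideal,
          where \<open>\<phi>\<close> vanishes.\<close>
        obtain r where r: "hom_part d (linear_form h ^ Suc (nonorth_count X h) * q) =
            linear_form h ^ Suc (nonorth_count X h) * r"
          using hom_part_linear_form_power_mult by blast
        have "r * linear_form h ^ Suc (nonorth_count X h) \<in> I_plus X \<eta>"
          using linear_form_power_in_I_plus[OF assms(2) h] unfolding I_plus_def by (rule ideal.span_scale)
        then show "pairing q ((dir_deriv h ^^ Suc (nonorth_count X h)) f) = 0"
          unfolding pairing_linear_form_power_mult[symmetric] f r
          by (intro I) (simp only: mult.commute)
      qed
      then show ?thesis
        using degree_line_poly_le_iff[of UNIV h f "nonorth_count X h"] by simp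
    qed
    then obtain g where g: "g \<in> P_plus X" "\<forall>u. eval_at u f = eval_at u g"
      using P_plus_of_facet_degrees[of UNIV X f] assms(1) by auto
    then have "f = g" by (intro eval_at_inject) simp
    \<comment> \<open>The spanning products are homogeneous, so \<open>\<phi>\<close> also vanishes
      on the homogeneous parts of members of \<open>P_plus\<close>.\<close>
    have vanish: "\<phi> (hom_part d p) = 0" if "p \<in> P_plus X" for p
      using that
    proof (induction rule: P_plus_induct)
      case (prod Y)
      then show ?case
        using P[OF form_prod_in_P_plus] by (simp add: hom_part_form_prod when_def l.zero)
    qed (simp_all add: l.zero hom_part_add l.add hom_part_scale l.scale)
    have "pairing (conj_cpoly f) f = 0"
      unfolding f using vanish conj_cpoly_P_plus g(1) \<open>f = g\<close> by blast
    then have "f = 0" by (rule pairing_conj_definite)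
    then show ?thesis using f[of q] by simp
  qed
  moreover obtain N where "x = (\<Sum>d<N. hom_part d x)"
    using hom_part_decomposition by blast
  ultimately have "\<phi> x = 0"
    using l.sum[of "\<lambda>d. hom_part d x" "{..<N}"] by simp
  with \<phi>(3) show False by simp
qed

theorem proposition1p2:
  fixes X :: "(real ^ 'n::finite) multiset"
    and \<eta> :: "(real ^ 'n) set \<Rightarrow> real ^ 'n"
  assumes nonzero: "0 \<notin># X"
    and full_rank: "dim (set_mset X) = CARD('n)"
    and normals: "normal_choice X \<eta>"
  shows "cpoly_direct_sum UNIV (P_plus X) (I_plus X \<eta>)"
proof -
  have "p = 0" if "p \<in> P_plus X" "p \<in> I_plus X \<eta>" for p
  proof -
    have conj_conj: "conj_cpoly (conj_cpoly p) = p"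
      by (rule poly_mapping_eqI) simp
    \<comment> \<open>The ideal member stands on the left in the orthogonality relation, so
      definiteness is applied to \<open>conj_cpoly p\<close> instead of \<open>p\<close>.\<close>
    have "pairing p (conj_cpoly p) = 0"
      by (rule pairing_I_plus_P_plus[OF normals that(2) conj_cpoly_P_plus[OF that(1)]])
    then have "conj_cpoly p = 0"
      by (intro pairing_conj_definite) (simp only: conj_conj)
    then show ?thesis
      using conj_conj by simp
  qed
  then have "P_plus X \<inter> I_plus X \<eta> = {0}"
    using cpoly.subspace_0[OF subspace_P_plus] cpoly.subspace_0[OF subspace_I_plus] by blast
  moreover have "UNIV = {u + w |u w. u \<in> P_plus X \<and> w \<in> I_plus X \<eta>}"
    using P_plus_add_I_plus[OF separates_UNIV_of_full_rank[OF full_rank] normals] by blast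
  ultimately show ?thesis
    by (simp add: cpoly_direct_sum_def subspace_P_plus subspace_I_plus)
qed

end
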